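(* Let $(\mathcal A,p)$ be a real seminormed involutive algebra, $V$ a complex Hilbert space, and let $\varphi\colon\mathcal A\to B(V)$ be dilatable, completely positive, homogeneous of degree $n\in\mathbb N_0$, and bounded on $\mathrm{ball}(\mathcal A,p)$. Then $\varphi$ is a continuous polynomial which is homogeneous of degree $n$ (continuity being with respect to the topology on $\mathcal A$ defined by $p$).
   Context: A real seminormed involutive algebra $(\mathcal A,p)$ is a real associative algebra $\mathcal A$ (not necessarily unital) with a real-linear involutive antiautomorphism $a\mapsto a^*$ and a seminorm $p$ satisfying $p(ab)\le p(a)p(b)$, $p(a^* )=p(a)$, and $p(\mathbf 1)=1$ if $\mathcal A$ is unital. $\mathrm{ball}(\mathcal A,p)=\{a\in\mathcal A:p(a)<1\}$. For an involutive algebra $\mathcal C$, $\mathcal C_+:=\mathrm{conv}\{c^*c:c\in\mathcal C\}$, and $M_n(\mathcal C)$ is an involutive algebra with $(c_{ij})^*=(c_{ji}^* )$. A (not necessarily linear) map $\varphi\colon\mathcal A\to B(V)$ is completely positive if for all $m\ge1$ and $(a_{ij})\in M_m(\mathcal A)_+$ the matrix $(\varphi(a_{ij}))\in M_m(B(V))$ is positive. $\varphi$ is dilatable if, with respect to the involutive semigroup $(\mathcal A,\cdot)$, there exist a $*$-representation $\pi\colon(\mathcal A,\cdot)\to B(\mathcal H)$ (multiplicative, $\pi(a^* )=\pi(a)^*$, not assumed linear) on a complex Hilbert space and a bounded linear operator $\iota\colon V\to\mathcal H$ with $\varphi(a)=\iota^*\pi(a)\iota$ for all $a\in\mathcal A$.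 Homogeneous of degree $n$ means $\varphi(ra)=r^n\varphi(a)$ for all $0<r<1$ and $a\in\mathcal A$ (equivalently for all $r>0$). A polynomial homogeneous of degree $n$ is a map of the form $a\mapsto\beta(a,\dots,a)$ with $\beta\colon\mathcal A^n\to B(V)$ real $n$-linear (a constant if $n=0$). *)

theory Defs
  imports "HOL-Analysis.Analysis"
begin

text \<open>Complex Hilbert spaces. The real normed structure is kept compatible with the complex one, so
  that the real bounded operators \<open>'a \<Rightarrow>\<^sub>L 'b\<close> and their operator norm can be used. The inner product
  is conjugate linear in its first argument.\<close>

class complex_vector = real_vector +
  fixes scaleC :: "complex \<Rightarrow> 'a \<Rightarrow> 'a" (infixr "*\<^sub>C" 75)
  assumes scaleC_add_right: "c *\<^sub>C (x + y) = c *\<^sub>C x + c *\<^sub>C y"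
    and scaleC_add_left: "(c + d) *\<^sub>C x = c *\<^sub>C x + d *\<^sub>C x"
    and scaleC_scaleC: "c *\<^sub>C (d *\<^sub>C x) = (c * d) *\<^sub>C x"
    and scaleR_scaleC: "r *\<^sub>R x = complex_of_real r *\<^sub>C x"

class complex_inner = complex_vector + real_normed_vector +
  fixes cinner :: "'a \<Rightarrow> 'a \<Rightarrow> complex"
  assumes cinner_commute: "cinner x y = cnj (cinner y x)"
    and cinner_add_right: "cinner x (y + z) = cinner x y + cinner x z"
    and cinner_scaleC_right: "cinner x (c *\<^sub>C y) = c * cinner x y"
    and cinner_nonneg: "0 \<le> Re (cinner x x)"
    and cinner_eq_zero_iff: "cinner x x = 0 \<longleftrightarrow> x = 0"
    and norm_eq_sqrt_cinner: "norm x = sqrt (Re (cinner x x))"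

class complex_hilbert_space = complex_inner + complete_space

text \<open>The bounded complex linear operators, as a subset of the bounded real linear ones.\<close>

definition cblinops :: "('a::complex_inner \<Rightarrow>\<^sub>L 'b::complex_inner) set" where
  "cblinops = {T. \<forall>c x. blinfun_apply T (c *\<^sub>C x) = c *\<^sub>C blinfun_apply T x}"

text \<open>\<open>S\<close> is the Hilbert space adjoint of \<open>T\<close>; by nondegeneracy there is at most one such \<open>S\<close>.\<close>

definition is_cadjoint ::
  "('b::complex_inner \<Rightarrow>\<^sub>L 'a::complex_inner) \<Rightarrow> ('a \<Rightarrow>\<^sub>L 'b) \<Rightarrow> bool" where
  "is_cadjoint S T \<longleftrightarrow> (\<forall>x y. cinner (S y) x = cinner y (T x))"

text \<open>The class \<open>real_algebra\<close> does not require a unit, hence the form of \<open>p_unit\<close>.\<close>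

locale seminormed_involutive_algebra =
  fixes star :: "'a::real_algebra \<Rightarrow> 'a" and p :: "'a \<Rightarrow> real"
  assumes star_linear: "linear star"
    and star_mult: "star (a * b) = star b * star a"
    and star_star: "star (star a) = a"
    and p_add: "p (a + b) \<le> p a + p b"
    and p_scaleR: "p (r *\<^sub>R a) = \<bar>r\<bar> * p a"
    and p_mult: "p (a * b) \<le> p a * p b"
    and p_star: "p (star a) = p a"
    and p_unit: "(\<And>a. e * a = a \<and> a * e = a) \<Longrightarrow> p e = 1"

definition seminorm_ball :: "('a \<Rightarrow> real) \<Rightarrow> 'a set" where
  "seminorm_ball p = {a. p a < 1}"

definition seminorm_topology :: "('a::real_vector \<Rightarrow> real) \<Rightarrow> 'a topology" where
  "seminorm_topology p = topology_generated_by {{y. p (y - x) < e} |x e. 0 < e}"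

text \<open>An \<open>m \<times> m\<close> matrix over \<open>'a\<close> is a function of two indices, of which only the values at
  indices below \<open>m\<close> are relevant.\<close>

definition mat_star :: "('a \<Rightarrow> 'a) \<Rightarrow> (nat \<Rightarrow> nat \<Rightarrow> 'a) \<Rightarrow> nat \<Rightarrow> nat \<Rightarrow> 'a" where
  "mat_star star c = (\<lambda>i j. star (c j i))"

definition mat_mult ::
  "nat \<Rightarrow> (nat \<Rightarrow> nat \<Rightarrow> 'a::real_algebra) \<Rightarrow> (nat \<Rightarrow> nat \<Rightarrow> 'a) \<Rightarrow> nat \<Rightarrow> nat \<Rightarrow> 'a" where
  "mat_mult m c d = (\<lambda>i j. \<Sum>l<m. c i l * d l j)"

text \<open>The set \<open>M\<^sub>m(A)\<^sub>+\<close>, i.e. the finite convex combinations of matrices \<open>c\<^sup>* c\<close>.\<close>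

definition mat_pos ::
  "('a::real_algebra \<Rightarrow> 'a) \<Rightarrow> nat \<Rightarrow> (nat \<Rightarrow> nat \<Rightarrow> 'a) set" where
  "mat_pos star m = {a. \<exists>(N::nat) (t :: nat \<Rightarrow> real) (c :: nat \<Rightarrow> nat \<Rightarrow> nat \<Rightarrow> 'a).
      (\<forall>k<N. 0 \<le> t k) \<and> (\<Sum>k<N. t k) = 1 \<and>
      (\<forall>i<m. \<forall>j<m. a i j = (\<Sum>k<N. t k *\<^sub>R mat_mult m (mat_star star (c k)) (c k) i j))}"

text \<open>Positivity of the operator on \<open>V\<^sup>m\<close> given by an \<open>m \<times> m\<close> matrix of operators on \<open>V\<close>.\<close>

definition op_mat_positive ::
  "nat \<Rightarrow> (nat \<Rightarrow> nat \<Rightarrow> 'v::complex_inner \<Rightarrow>\<^sub>L 'v) \<Rightarrow> bool" where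
  "op_mat_positive m T \<longleftrightarrow>
     (\<forall>v :: nat \<Rightarrow> 'v. (\<Sum>i<m. \<Sum>j<m. cinner (v i) (T i j (v j))) \<in> \<real>\<^sub>\<ge>\<^sub>0)"

definition completely_positive ::
  "('a::real_algebra \<Rightarrow> 'a) \<Rightarrow> ('a \<Rightarrow> 'v::complex_inner \<Rightarrow>\<^sub>L 'v) \<Rightarrow> bool" where
  "completely_positive star \<phi> \<longleftrightarrow>
     (\<forall>m\<ge>1. \<forall>a\<in>mat_pos star m. op_mat_positive m (\<lambda>i j. \<phi> (a i j)))"

definition star_representation ::
  "('a::times \<Rightarrow> 'a) \<Rightarrow> ('a \<Rightarrow> 'h::complex_inner \<Rightarrow>\<^sub>L 'h) \<Rightarrow> bool" where
  "star_representation star \<pi> \<longleftrightarrow>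
     range \<pi> \<subseteq> cblinops \<and>
     (\<forall>a b. \<pi> (a * b) = \<pi> a o\<^sub>L \<pi> b) \<and>
     (\<forall>a. is_cadjoint (\<pi> (star a)) (\<pi> a))"

text \<open>Dilatability on a Hilbert space of type \<open>'h\<close>. HOL cannot quantify existentially over types;
  as a hypothesis of a theorem in which \<open>'h\<close> is a type variable occurring nowhere else, it
  expresses that a dilation exists on some complex Hilbert space.\<close>

definition dilatable ::
  "'h::complex_hilbert_space itself \<Rightarrow> ('a::times \<Rightarrow> 'a) \<Rightarrow>
   ('a \<Rightarrow> 'v::complex_hilbert_space \<Rightarrow>\<^sub>L 'v) \<Rightarrow> bool" where
  "dilatable _ star \<phi> \<longleftrightarrow>
     (\<exists>(\<pi> :: 'a \<Rightarrow> 'h \<Rightarrow>\<^sub>L 'h) (\<iota> :: 'v \<Rightarrow>\<^sub>L 'h) (\<iota>' :: 'h \<Rightarrow>\<^sub>L 'v).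
        star_representation star \<pi> \<and> \<iota> \<in> cblinops \<and> is_cadjoint \<iota>' \<iota> \<and>
        (\<forall>a. \<phi> a = \<iota>' o\<^sub>L \<pi> a o\<^sub>L \<iota>))"

definition homogeneous :: "nat \<Rightarrow> ('a::real_vector \<Rightarrow> 'b::real_vector) \<Rightarrow> bool" where
  "homogeneous n \<phi> \<longleftrightarrow> (\<forall>r a. 0 < r \<and> r < 1 \<longrightarrow> \<phi> (r *\<^sub>R a) = r ^ n *\<^sub>R \<phi> a)"

text \<open>Real \<open>n\<close>-linear maps into the subspace \<open>S\<close>; the points of \<open>A\<^sup>n\<close> are the lists of length \<open>n\<close>.\<close>

definition multilinear_into ::
  "nat \<Rightarrow> 'b set \<Rightarrow> ('a::real_vector list \<Rightarrow> 'b::real_vector) \<Rightarrow> bool" where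
  "multilinear_into n S \<beta> \<longleftrightarrow>
     (\<forall>xs. length xs = n \<longrightarrow> \<beta> xs \<in> S \<and> (\<forall>i<n. linear (\<lambda>x. \<beta> (xs[i := x]))))"

definition homogeneous_polynomial_into ::
  "nat \<Rightarrow> 'b set \<Rightarrow> ('a::real_vector \<Rightarrow> 'b::real_vector) \<Rightarrow> bool" where
  "homogeneous_polynomial_into n S \<phi> \<longleftrightarrow>
     (\<exists>\<beta>. multilinear_into n S \<beta> \<and> (\<forall>a. \<phi> a = \<beta> (replicate n a)))"

end

theory Submission
  imports Defs
begin

text \<open>The polynomials of degree at most \<open>n\<close> are the well-behaved functions all of whose differences of
order \<open>n + 1\<close> vanish, and the proof produces this vanishing in three stages.

\<^item> Complete positivity, applied to sums of \<open>c\<^sup>* c\<close> with \<open>c\<close> having a single nonzero row, says that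
  \<open>\<phi> (\<Sum>k. x k\<^sup>* y k)\<close> is a positive definite kernel in the tuples \<open>x\<close>, \<open>y\<close>. Subtracting the point
  \<open>x\<close> with one entry deleted from \<open>x\<close> turns that entry into a difference, so that the iterated
  differences of \<open>\<phi>\<close> with increments \<open>x i\<^sup>* y i\<close> are positive definite kernels as well
  (\<open>pos_def_kernel_mdiff\<close>). On the diagonal this says that \<open>a \<mapsto> \<langle>v, \<phi> a v\<rangle>\<close> is absolutely monotone
  on the cone of sums of squares \<open>s\<^sup>* s\<close>. An absolutely monotone function that is homogeneous of
  degree \<open>n\<close> has vanishing differences of order \<open>n + 1\<close>: if \<open>h\<close> dominates the base point and
  all increments, such a difference is at most the one with base point \<open>h\<close> and all increments \<open>h\<close>,
  which is a difference of order \<open>n + 1\<close> of \<open>t\<^sup>n\<close> (\<open>mdiff_homogeneous_eq_0\<close>). A positive definite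
  kernel that vanishes on the diagonal is zero, hence so are the differences of order \<open>n + 1\<close> of
  \<open>\<phi>\<close> with base point and increments of the form \<open>b\<^sup>* a c\<close> (\<open>mdiff_sandwich_eq_0\<close>).

\<^item> The dilation removes the factors \<open>b\<^sup>*\<close> and \<open>c\<close>. If \<open>T\<close> is the corresponding difference of \<open>\<pi>\<close>,
  the first stage says that \<open>\<iota>\<^sup>* X T Y \<iota> = 0\<close> for all \<open>X\<close>, \<open>Y\<close> in the \<open>*\<close>-algebra spanned by the
  range of \<open>\<pi>\<close>, to which \<open>T\<close> itself belongs. With \<open>X = T\<^sup>*\<close> and \<open>Y = T\<^sup>* T\<close> this gives
  \<open>T\<^sup>* T \<iota> = 0\<close>, whence \<open>T \<iota> = 0\<close> and \<open>\<iota>\<^sup>* T \<iota> = 0\<close> (\<open>mdiff_dilation_eq_0\<close>). Some such step is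
  unavoidable in an algebra without unit, whose elements need not be sums of products.

\<^item> The \<open>n\<close>-th difference of \<open>\<phi>\<close> at \<open>0\<close>, divided by \<open>n!\<close>, is now additive in every increment, and
  bounded on bounded sets because \<open>\<phi>\<close> is; so it is real multilinear, and \<open>\<phi>\<close> is its restriction
  to the diagonal by homogeneity. Continuity follows from the bound.\<close>

section \<open>Iterated differences\<close>

text \<open>The domain is only required to be a monoid, so that differences along the multiples of a
vector become differences of functions on \<open>nat\<close>.\<close>
fun mdiff :: "'x::comm_monoid_add list \<Rightarrow> ('x \<Rightarrow> 'b::ab_group_add) \<Rightarrow> 'x \<Rightarrow> 'b" where
  "mdiff [] f x = f x"
| "mdiff (h # hs) f x = mdiff hs f (x + h) - mdiff hs f x"

lemma mdiff_zero [simp]: "mdiff hs (\<lambda>_. 0) x = 0"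
  by (induction hs arbitrary: x) auto

lemma mdiff_append: "mdiff (as @ bs) f x = mdiff as (mdiff bs f) x"
  by (induction as arbitrary: x) auto

lemma mdiff_additive:
  assumes "\<And>u v. L (u - v) = L u - L v"
  shows "L (mdiff hs f x) = mdiff hs (\<lambda>y. L (f y)) x"
  by (induction hs arbitrary: x) (auto simp: assms)

text \<open>The substitution rule; \<open>g\<close> need only be affine in the directions \<open>hs\<close>.\<close>
lemma mdiff_comp:
  assumes "\<And>y h. h \<in> set hs \<Longrightarrow> g (y + h) = g y + L h"
  shows "mdiff hs (\<lambda>y. f (g y)) y = mdiff (map L hs) f (g y)"
  using assms by (induction hs arbitrary: y) auto

lemma mdiff_snoc: "mdiff (hs @ [h]) f x = mdiff (h # hs) f x"
  by (induction hs arbitrary: x) (auto simp: add_ac)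

lemma mdiff_middle: "mdiff (as @ h # bs) f x = mdiff (h # as @ bs) f x"
  using mdiff_append[of "as @ [h]" bs f x] mdiff_append[of "h # as" bs f x]
    mdiff_snoc[of as h "mdiff bs f" x] by (simp del: mdiff.simps)

text \<open>Differences are additive in an increment up to a shift of the base point. The shift is
harmless in two situations: under positivity, and when differences of one order higher vanish.\<close>
lemma mdiff_Cons_add:
  "mdiff ((g + h) # hs) f x = mdiff (g # hs) f x + mdiff (h # hs) f (x + g)"
  by (simp add: add_ac)

text \<open>The Leibniz rule for multiplication by an affine function, which reduces the differences of
powers to lower powers.\<close>
lemma mdiff_replicate_times:
  fixes f :: "nat \<Rightarrow> real"
  shows "mdiff (replicate (Suc k) 1) (\<lambda>j. (real j + c) * f j) x =
    (real x + c + real (Suc k)) * mdiff (replicate (Suc k) 1) f x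
      + real (Suc k) * mdiff (replicate k 1) f x"
proof (induction k arbitrary: x)
  case 0
  show ?case by (simp add: algebra_simps)
next
  case (Suc k)
  have "mdiff (replicate (Suc (Suc k)) 1) (\<lambda>j. (real j + c) * f j) x =
    mdiff (replicate (Suc k) 1) (\<lambda>j. (real j + c) * f j) (x + 1)
    - mdiff (replicate (Suc k) 1) (\<lambda>j. (real j + c) * f j) x" by simp
  also have "\<dots> = (real x + c + real (Suc (Suc k))) * mdiff (replicate (Suc (Suc k)) 1) f x
      + real (Suc (Suc k)) * mdiff (replicate (Suc k) 1) f x"
    unfolding Suc by (simp add: algebra_simps)
  finally show ?case .
qed

lemma mdiff_power_eq_0:
  assumes "m < k"
  shows "mdiff (replicate k 1) (\<lambda>j. (real j + c) ^ m) x = 0"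
  using assms
proof (induction m arbitrary: k x)
  case 0
  then obtain k' where "k = Suc k'" by (cases k) auto
  moreover have "mdiff (replicate k' 1) (\<lambda>j::nat. 1::real) x = mdiff (replicate k' 1) (\<lambda>j::nat. 1::real) (x + 1)"
    for x by (induction k' arbitrary: x) auto
  ultimately show ?case by simp
next
  case (Suc m)
  then obtain k' where k: "k = Suc k'" and "m < k'" by (cases k) auto
  then show ?case
    using mdiff_replicate_times[of k' c "\<lambda>j. (real j + c) ^ m" x] Suc.IH[of k x] Suc.IH[of k' x]
    by simp
qed

lemma mdiff_power_eq_fact: "mdiff (replicate m 1) (\<lambda>j. real j ^ m) x = fact m"
proof (induction m arbitrary: x)
  case (Suc m)
  show ?case
    using mdiff_replicate_times[of m 0 "\<lambda>j. real j ^ m" x] Suc[of x]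
      mdiff_power_eq_0[of m "Suc m" 0 x] by simp
qed simp

section \<open>Absolutely monotone homogeneous functions\<close>

definition sums_of :: "'x::comm_monoid_add set \<Rightarrow> 'x set" where
  "sums_of G = {sum_list gs |gs. set gs \<subseteq> G}"

lemma sums_of_0: "0 \<in> sums_of G"
  unfolding sums_of_def by (force intro: exI[of _ "[]"])

lemma sums_of_add:
  assumes "x \<in> sums_of G" "y \<in> sums_of G" shows "x + y \<in> sums_of G"
proof -
  from assms obtain as bs where "x = sum_list as" "y = sum_list bs" "set as \<subseteq> G" "set bs \<subseteq> G"
    unfolding sums_of_def by auto
  then have "x + y = sum_list (as @ bs)" "set (as @ bs) \<subseteq> G" by auto
  then show ?thesis unfolding sums_of_def by blast
qed

lemma sums_of_generator: "g \<in> G \<Longrightarrow> g \<in> sums_of G"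
  unfolding sums_of_def by (force intro: exI[of _ "[g]"])

text \<open>It suffices to test absolute monotonicity with increments that generate the cone, since an
increment that is a sum splits into a sum of differences with shifted base points.\<close>
lemma mdiff_nonneg_sums_of:
  fixes F :: "'x::comm_monoid_add \<Rightarrow> real"
  assumes nonneg: "\<And>gs x. set gs \<subseteq> G \<Longrightarrow> x \<in> sums_of G \<Longrightarrow> 0 \<le> mdiff gs F x"
    and "set hs \<subseteq> sums_of G" "x \<in> sums_of G"
  shows "0 \<le> mdiff hs F x"
proof -
  \<comment> \<open>Induction on the number of general increments; generators split off from one of them are
    collected in \<open>gs\<close>.\<close>
  have "0 \<le> mdiff (hs @ gs) F x" if "set hs \<subseteq> sums_of G" "set gs \<subseteq> G" "x \<in> sums_of G" for hs gs x
    using that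
  proof (induction hs arbitrary: gs x)
    case Nil
    then show ?case using nonneg by simp
  next
    case (Cons h hs)
    note outer = Cons.IH
    from Cons.prems obtain rs where h: "h = sum_list rs" and rs: "set rs \<subseteq> G" unfolding sums_of_def by auto
    have "0 \<le> mdiff (sum_list rs # hs @ gs) F x"
      using rs Cons.prems(3)
    proof (induction rs arbitrary: x)
      case Nil
      then show ?case by simp
    next
      case (Cons r rs)
      have "0 \<le> mdiff (hs @ r # gs) F x"
        using Cons.prems \<open>set (h # hs) \<subseteq> sums_of G\<close> \<open>set gs \<subseteq> G\<close> by (intro outer) auto
      moreover have "0 \<le> mdiff (sum_list rs # hs @ gs) F (x + r)"
        using Cons.prems by (intro Cons.IH) (auto intro: sums_of_add sums_of_generator)
      ultimately show ?case
        unfolding sum_list.Cons mdiff_Cons_add mdiff_middle by linarith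
    qed
    then show ?case using h by simp
  qed
  from this[of hs "[]"] assms show ?thesis by simp
qed

text \<open>The differences of an absolutely monotone function increase with each increment. In the
induction, the increments already replaced by \<open>h\<close> move to the list \<open>as\<close>.\<close>
lemma mdiff_le_replicate:
  fixes F :: "'x::comm_monoid_add \<Rightarrow> real"
  assumes nonneg: "\<And>hs x. set hs \<subseteq> C \<Longrightarrow> x \<in> C \<Longrightarrow> 0 \<le> mdiff hs F x"
    and add: "\<And>x y. x \<in> C \<Longrightarrow> y \<in> C \<Longrightarrow> x + y \<in> C"
    and "set hs \<subseteq> {g \<in> C. \<exists>d\<in>C. h = g + d}" "set as \<subseteq> C" "h \<in> C" "x \<in> C"
  shows "mdiff (hs @ as) F x \<le> mdiff (replicate (length hs) h @ as) F x"
  using assms(3-6)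
proof (induction hs arbitrary: as)
  case (Cons g hs)
  then obtain d where d: "h = g + d" "g \<in> C" "d \<in> C" by auto
  have "0 \<le> mdiff (d # hs @ as) F (x + g)"
    using Cons.prems d by (intro nonneg) (auto intro: add)
  then have "mdiff (g # hs @ as) F x \<le> mdiff (h # hs @ as) F x"
    unfolding d(1) mdiff_Cons_add by simp
  also have "\<dots> = mdiff (hs @ h # as) F x" by (rule mdiff_middle[symmetric])
  also have "\<dots> \<le> mdiff (replicate (length hs) h @ h # as) F x"
    using Cons.prems by (intro Cons.IH) auto
  also have "\<dots> = mdiff (h # replicate (length hs) h @ as) F x" by (rule mdiff_middle)
  finally show ?case by (simp del: mdiff.simps)
qed simp

text \<open>For an absolutely monotone \<open>F\<close>, raising all increments and the base point to one common vector
\<open>h\<close> can only raise the difference. On the ray through \<open>h\<close> homogeneity makes \<open>F\<close> a multiple of \<open>t\<^sup>n\<close>,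
whose differences of higher order are zero.\<close>
lemma mdiff_homogeneous_eq_0:
  fixes F :: "'x::real_vector \<Rightarrow> real"
  assumes nonneg: "\<And>hs x. set hs \<subseteq> C \<Longrightarrow> x \<in> C \<Longrightarrow> 0 \<le> mdiff hs F x"
    and zero: "0 \<in> C" and add: "\<And>x y. x \<in> C \<Longrightarrow> y \<in> C \<Longrightarrow> x + y \<in> C"
    and hom: "\<And>k x. F (real (Suc k) *\<^sub>R x) = real (Suc k) ^ n * F x"
    and hs: "set hs \<subseteq> C" "n < length hs" and x: "x \<in> C"
  shows "mdiff hs F x = 0"
proof -
  define h where "h = x + sum_list hs"
  have sumC: "sum_list gs \<in> C" if "set gs \<subseteq> C" for gs
    using that by (induction gs) (auto intro: zero add)
  have hC: "h \<in> C" unfolding h_def using hs x by (intro add sumC)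
  have dominated: "\<exists>d\<in>C. h = g + d" if g: "g \<in> set hs" for g
  proof -
    obtain as bs where "hs = as @ g # bs" using split_list[OF g] by blast
    then show ?thesis unfolding h_def using hs x
      by (intro bexI[of _ "x + (sum_list as + sum_list bs)"]) (auto intro!: add sumC simp: add_ac)
  qed
  have "mdiff (hs @ []) F x \<le> mdiff (replicate (length hs) h @ []) F x"
    using hs x hC dominated by (intro mdiff_le_replicate[where C = C] nonneg add) auto
  also have "\<dots> \<le> mdiff (replicate (length hs) h) F (x + sum_list hs)"
  proof -
    have "set (sum_list hs # replicate (length hs) h) \<subseteq> C" using hC sumC[OF hs(1)] by auto
    from nonneg[OF this x] show ?thesis by simp
  qed
  also have "\<dots> = mdiff (replicate (length hs) h) F (real (Suc 0) *\<^sub>R h)" by (simp add: h_def)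
  \<comment> \<open>With base point \<open>h\<close> instead of \<open>0\<close>, only positive multiples of \<open>h\<close> occur, for which
    homogeneity determines \<open>F\<close>.\<close>
  also have "\<dots> = mdiff (replicate (length hs) 1) (\<lambda>j. F (real (Suc j) *\<^sub>R h)) 0"
    using mdiff_comp[of "replicate (length hs) (1::nat)" "\<lambda>j. real (Suc j) *\<^sub>R h" "\<lambda>_. h" F 0]
    by (simp add: algebra_simps scaleR_2)
  also have "\<dots> = F h * mdiff (replicate (length hs) 1) (\<lambda>j. (real j + 1) ^ n) 0"
    unfolding hom
    using mdiff_additive[of "\<lambda>t. F h * t" "replicate (length hs) (1::nat)" "\<lambda>j. (real j + 1) ^ n" 0]
    by (simp add: algebra_simps)
  also have "\<dots> = 0" using mdiff_power_eq_0[OF hs(2), of 1 0] by simp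
  finally have "mdiff hs F x \<le> 0" by simp
  with nonneg[OF hs(1) x] show ?thesis by simp
qed

section \<open>Positive definite kernels\<close>

lemma cinner_add_left: "cinner (x + y) z = cinner x z + cinner y z"
  by (metis cinner_commute cinner_add_right complex_cnj_add)

lemma cinner_diff_right: "cinner x (y - z) = cinner x y - cinner x z"
  using cinner_add_right[of x "y - z" z] by simp

lemma cinner_diff_left: "cinner (x - y) z = cinner x z - cinner y z"
  using cinner_add_left[of "x - y" y z] by simp

lemma cinner_0_right [simp]: "cinner x 0 = 0"
  using cinner_diff_right[of x 0 0] by simp

lemma cinner_0_left [simp]: "cinner 0 x = 0"
  using cinner_diff_left[of 0 0 x] by simp

lemma cinner_minus_right: "cinner x (- y) = - cinner x y"
  using cinner_diff_right[of x 0 y] by simp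

lemma cinner_minus_left: "cinner (- x) y = - cinner x y"
  using cinner_diff_left[of 0 x y] by simp

lemma cinner_scaleC_left: "cinner (c *\<^sub>C x) y = cnj c * cinner x y"
  by (metis cinner_commute cinner_scaleC_right complex_cnj_mult)

text \<open>A list of pairs \<open>(x, v)\<close> stands for finitely many points with attached vectors; points may
be repeated. Lists make it easy to double a family of points.\<close>
definition pos_def_kernel :: "('x \<Rightarrow> 'x \<Rightarrow> 'v::complex_inner \<Rightarrow>\<^sub>L 'v) \<Rightarrow> bool" where
  "pos_def_kernel K \<longleftrightarrow>
     (\<forall>L. (\<Sum>P\<leftarrow>L. \<Sum>Q\<leftarrow>L. cinner (snd P) (K (fst P) (fst Q) (snd Q))) \<in> \<real>\<^sub>\<ge>\<^sub>0)"

text \<open>If \<open>K\<close> is the Gram kernel of vectors \<open>e x\<close>, the new kernel is the Gram kernel of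
\<open>e (f x) - e (g x)\<close>. Without constructing such vectors: attach \<open>v\<close> to \<open>f x\<close> and \<open>- v\<close> to \<open>g x\<close>.\<close>
lemma pos_def_kernel_diff:
  fixes f g :: "'y \<Rightarrow> 'x" and K :: "'x \<Rightarrow> 'x \<Rightarrow> 'v::complex_inner \<Rightarrow>\<^sub>L 'v"
  assumes "pos_def_kernel K"
  shows "pos_def_kernel (\<lambda>x y. K (f x) (f y) - K (f x) (g y) - K (g x) (f y) + K (g x) (g y))"
  unfolding pos_def_kernel_def
proof
  fix L :: "('y \<times> 'v) list"
  let ?L = "map (\<lambda>P. (f (fst P), snd P)) L @ map (\<lambda>P. (g (fst P), - snd P)) L"
  have "(\<Sum>P\<leftarrow>?L. \<Sum>Q\<leftarrow>?L. cinner (snd P) (K (fst P) (fst Q) (snd Q))) \<in> \<real>\<^sub>\<ge>\<^sub>0"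
    using assms unfolding pos_def_kernel_def by blast
  moreover have "(\<Sum>P\<leftarrow>?L. \<Sum>Q\<leftarrow>?L. cinner (snd P) (K (fst P) (fst Q) (snd Q))) =
    (\<Sum>P\<leftarrow>L. \<Sum>Q\<leftarrow>L. cinner (snd P) ((K (f (fst P)) (f (fst Q)) - K (f (fst P)) (g (fst Q))
      - K (g (fst P)) (f (fst Q)) + K (g (fst P)) (g (fst Q))) (snd Q)))"
    by (simp add: o_def sum_list_addf sum_list_subtractf blinfun.bilinear_simps cinner_add_right
        cinner_diff_right cinner_minus_right cinner_minus_left uminus_sum_list_map[symmetric, unfolded o_def])
  ultimately show "(\<Sum>P\<leftarrow>L. \<Sum>Q\<leftarrow>L. cinner (snd P) ((K (f (fst P)) (f (fst Q))
      - K (f (fst P)) (g (fst Q)) - K (g (fst P)) (f (fst Q)) + K (g (fst P)) (g (fst Q))) (snd Q)))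
      \<in> \<real>\<^sub>\<ge>\<^sub>0" by simp
qed

lemma pos_def_kernel_diag:
  assumes "pos_def_kernel K" shows "cinner v (K x x v) \<in> \<real>\<^sub>\<ge>\<^sub>0"
  using assms[unfolded pos_def_kernel_def, rule_format, of "[(x, v)]"] by simp

text \<open>The degenerate case of the Cauchy-Schwarz inequality.\<close>
lemma pos_def_kernel_eq_0:
  assumes K: "pos_def_kernel K" and linear: "\<And>x y. K x y \<in> cblinops"
    and diag: "\<And>x v. Re (cinner v (K x x v)) = 0"
  shows "K x y = 0"
proof (rule blinfun_eqI)
  fix w
  define v where "v = K x y w"
  define \<alpha> \<beta> where "\<alpha> = cinner v (K x y w)" and "\<beta> = cinner w (K y x v)"
  have diag0: "cinner u (K z z u) = 0" for z u
    using pos_def_kernel_diag[OF K, of u z] diag[of u z] by (simp add: complex_nonneg_Reals_iff complex_eq_iff)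
  \<comment> \<open>As the diagonal vanishes, the quadratic form on the two points is linear in \<open>(c, cnj c)\<close>, so
    the values \<open>1, -1, \<i>, -\<i>\<close> of \<open>c\<close> force it to be zero.\<close>
  have *: "cnj c * \<alpha> + c * \<beta> \<in> \<real>\<^sub>\<ge>\<^sub>0" for c
    using K[unfolded pos_def_kernel_def, rule_format, of "[(x, c *\<^sub>C v), (y, w)]"] linear[of y x]
    by (simp add: diag0 cinner_scaleC_left cinner_scaleC_right \<alpha>_def \<beta>_def cblinops_def add.commute)
  have "\<alpha> = 0"
    using *[of 1] *[of "- 1"] *[of \<i>] *[of "- \<i>"]
    by (simp add: complex_nonneg_Reals_iff complex_eq_iff)
  then show "K x y w = blinfun_apply 0 w"
    by (simp add: \<alpha>_def v_def cinner_eq_zero_iff)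
qed

lemma scaleC_diff_right: "c *\<^sub>C (x - y) = c *\<^sub>C x - c *\<^sub>C y"
  using scaleC_add_right[of c "x - y" y] by simp

lemma cblinops_diff: "S \<in> cblinops \<Longrightarrow> T \<in> cblinops \<Longrightarrow> S - T \<in> cblinops"
  unfolding cblinops_def by (simp add: blinfun.diff_left scaleC_diff_right)

lemma mdiff_cblinops: "range f \<subseteq> cblinops \<Longrightarrow> mdiff hs f x \<in> cblinops"
  by (induction hs arbitrary: x) (auto intro: cblinops_diff)

text \<open>The factors \<open>r > 1\<close> are covered by applying homogeneity with \<open>1 / r\<close>.\<close>
lemma homogeneous_scale:
  assumes "homogeneous n f" "0 < r"
  shows "f (r *\<^sub>R a) = r ^ n *\<^sub>R f a"
proof -
  consider "r < 1" | "r = 1" | "r > 1" by linarith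
  then show ?thesis
  proof cases
    case 3
    then have "f (inverse r *\<^sub>R r *\<^sub>R a) = inverse r ^ n *\<^sub>R f (r *\<^sub>R a)"
      using assms(1)[unfolded homogeneous_def, rule_format, of "inverse r" "r *\<^sub>R a"]
      by (auto simp: inverse_less_1_iff)
    with 3 show ?thesis by (simp add: power_inverse)
  qed (use assms in \<open>auto simp: homogeneous_def\<close>)
qed

section \<open>Kernels from complete positivity\<close>

context seminormed_involutive_algebra
begin

lemma star_0 [simp]: "star 0 = 0"
  using star_linear by (rule linear_0)

text \<open>The matrix with entries \<open>\<Sum>k. (x i k)\<^sup>* (x j k)\<close> is a sum of the matrices \<open>c\<^sup>* c\<close> for which \<open>c\<close> has
\<open>(x j k)\<^sub>j\<close> as its first row and zeros elsewhere.\<close>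
lemma pos_def_kernel_of_completely_positive:
  fixes \<phi> :: "'a \<Rightarrow> 'v::complex_inner \<Rightarrow>\<^sub>L 'v" and N :: nat
  assumes "completely_positive star \<phi>"
  shows "pos_def_kernel (\<lambda>x y. \<phi> (\<Sum>k<N. star (x k) * y k))"
  unfolding pos_def_kernel_def
proof
  fix L :: "((nat \<Rightarrow> 'a) \<times> 'v) list"
  define X V where "X i = fst (L ! i)" and "V i = snd (L ! i)" for i
  define a where "a i j = (\<Sum>k<N. star (X i k) * X j k)" for i j :: nat
  define m where "m = length L"
  have eq: "(\<Sum>P\<leftarrow>L. \<Sum>Q\<leftarrow>L. cinner (snd P) (\<phi> (\<Sum>k<N. star (fst P k) * fst Q k) (snd Q)))
    = (\<Sum>i<m. \<Sum>j<m. cinner (V i) (\<phi> (a i j) (V j)))"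
    by (simp add: sum_list_sum_nth a_def X_def V_def m_def lessThan_atLeast0)
  show "(\<Sum>P\<leftarrow>L. \<Sum>Q\<leftarrow>L. cinner (snd P) (\<phi> (\<Sum>k<N. star (fst P k) * fst Q k) (snd Q)))
    \<in> \<real>\<^sub>\<ge>\<^sub>0"
  proof (cases "m = 0")
    case False
    \<comment> \<open>A factor \<open>Suc N\<close> compensates for the equal weights of a convex combination; the additional
      summand \<open>c N = 0\<close> keeps the weights meaningful for \<open>N = 0\<close>.\<close>
    define c where "c k l j = (if l = 0 \<and> k < N then sqrt (real (Suc N)) *\<^sub>R X j k else 0)"
      for k l j :: nat
    have c: "mat_mult m (mat_star star (c k)) (c k) i j =
      (if k < N then real (Suc N) *\<^sub>R (star (X i k) * X j k) else 0)" for k i j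
    proof -
      have "mat_mult m (mat_star star (c k)) (c k) i j =
        (\<Sum>l<m. if l = 0 then star (c k 0 i) * c k 0 j else 0)"
        unfolding mat_mult_def mat_star_def by (intro sum.cong) (auto simp: c_def)
      also have "\<dots> = star (c k 0 i) * c k 0 j" using False by simp
      finally show ?thesis by (simp add: c_def linear_scale[OF star_linear] del: of_nat_Suc)
    qed
    have "a i j = (\<Sum>k<Suc N. inverse (real (Suc N)) *\<^sub>R mat_mult m (mat_star star (c k)) (c k) i j)"
      for i j unfolding c a_def by (simp del: of_nat_Suc)
    then have "a \<in> mat_pos star m"
      unfolding mat_pos_def mem_Collect_eq
      by (intro exI[of _ "Suc N"] exI[of _ "\<lambda>_. inverse (real (Suc N))"] exI[of _ c])
        (simp del: sum.lessThan_Suc of_nat_Suc)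
    then have "op_mat_positive m (\<lambda>i j. \<phi> (a i j))"
      using assms False unfolding completely_positive_def by auto
    then show ?thesis unfolding eq op_mat_positive_def by blast
  qed (simp add: eq)
qed

text \<open>Each step takes the \<open>j\<close>-th entry out of the sum and makes it an increment, by applying
\<open>pos_def_kernel_diff\<close> to the maps \<open>x \<mapsto> x\<close> and \<open>x \<mapsto> x(j := 0)\<close>.\<close>
lemma pos_def_kernel_mdiff:
  fixes \<phi> :: "'a \<Rightarrow> 'v::complex_inner \<Rightarrow>\<^sub>L 'v"
  assumes cp: "completely_positive star \<phi>" and "j \<le> N"
  shows "pos_def_kernel (\<lambda>x y. mdiff (map (\<lambda>i. star (x i) * y i) [0..<j]) \<phi>
           (\<Sum>k\<in>{j..<N}. star (x k) * y k))"
  using assms(2)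
proof (induction j)
  case 0
  show ?case using pos_def_kernel_of_completely_positive[OF cp, of N] by (simp add: lessThan_atLeast0)
next
  case (Suc j)
  let ?K = "\<lambda>j x y. mdiff (map (\<lambda>i. star (x i) * y i) [0..<j]) \<phi> (\<Sum>k\<in>{j..<N}. star (x k) * y k)"
  let ?g = "\<lambda>x. x(j := 0)"
  have split: "(\<Sum>k\<in>{j..<N}. star (x k) * y k) = star (x j) * y j + (\<Sum>k\<in>{Suc j..<N}. star (x k) * y k)"
    for x y :: "nat \<Rightarrow> 'a"
    using Suc.prems by (simp add: sum.atLeast_Suc_lessThan)
  have "?K (Suc j) x y = ?K j x y - ?K j x (?g y) - ?K j (?g x) y + ?K j (?g x) (?g y)" for x y
  proof -
    let ?D = "mdiff (map (\<lambda>i. star (x i) * y i) [0..<j]) \<phi> (\<Sum>k\<in>{Suc j..<N}. star (x k) * y k)"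
    have maps: "map (\<lambda>i. star (x i) * ?g y i) [0..<j] = map (\<lambda>i. star (x i) * y i) [0..<j]"
      "map (\<lambda>i. star (?g x i) * y i) [0..<j] = map (\<lambda>i. star (x i) * y i) [0..<j]"
      "map (\<lambda>i. star (?g x i) * ?g y i) [0..<j] = map (\<lambda>i. star (x i) * y i) [0..<j]"
      by auto
    have "?K j x (?g y) = ?D" "?K j (?g x) y = ?D" "?K j (?g x) (?g y) = ?D"
      unfolding maps split by simp_all
    moreover have "?K (Suc j) x y = ?K j x y - ?D"
      by (simp add: split mdiff_snoc add.commute)
    ultimately show ?thesis by simp
  qed
  then show ?case using pos_def_kernel_diff[of "?K j" "\<lambda>x. x" ?g] Suc by simp
qed

text \<open>On the diagonal, the base point and the increments are squares, and the kernel vanishes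
because \<open>a \<mapsto> \<langle>v, \<phi> a v\<rangle>\<close> is absolutely monotone and homogeneous on the cone generated by squares. A
positive definite kernel that vanishes on the diagonal vanishes everywhere.\<close>
lemma mdiff_products_eq_0:
  fixes \<phi> :: "'a \<Rightarrow> 'v::complex_inner \<Rightarrow>\<^sub>L 'v"
  assumes cp: "completely_positive star \<phi>" and linear: "range \<phi> \<subseteq> cblinops"
    and hom: "homogeneous n \<phi>" and j: "n < j"
  shows "mdiff (map (\<lambda>i. star (x i) * y i) [0..<j]) \<phi> (star (x j) * y j) = 0"
proof -
  let ?q = "\<lambda>s. star s * s"
  let ?K = "\<lambda>x y. mdiff (map (\<lambda>i. star (x i) * y i) [0..<j]) \<phi> (star (x j) * y j)"
  have pd: "pos_def_kernel ?K"
    using pos_def_kernel_mdiff[OF cp, of j "Suc j"] by simp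
  have diag: "Re (cinner v (?K x x v)) = 0" for x v
  proof -
    define F where "F a = Re (cinner v (\<phi> a v))" for a
    have mdiff_F: "mdiff hs F a = Re (cinner v (mdiff hs \<phi> a v))" for hs a
      unfolding F_def
      by (rule mdiff_additive[symmetric]) (simp add: blinfun.diff_left cinner_diff_right)
    have nonneg: "0 \<le> mdiff hs F a" if hs: "set hs \<subseteq> range ?q" and a: "a \<in> sums_of (range ?q)" for hs a
    proof -
      obtain ss where ss: "hs = map ?q ss" using hs ex_map_conv[of hs ?q] by auto
      from a obtain gs where gs: "a = sum_list gs" "set gs \<subseteq> range ?q" unfolding sums_of_def by auto
      then obtain rs where rs: "gs = map ?q rs" using ex_map_conv[of gs ?q] by auto
      define y where "y k = (ss @ rs) ! k" for k
      define j N where "j = length ss" and "N = length (ss @ rs)"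
      have "hs = map (\<lambda>i. ?q (y i)) [0..<j]"
        by (intro nth_equalityI) (auto simp: ss y_def j_def nth_append)
      moreover have "a = (\<Sum>k\<in>{j..<N}. ?q (y k))"
      proof -
        have "a = (\<Sum>k\<in>{0..<length rs}. ?q (rs ! k))"
          by (simp add: gs rs sum_list_sum_nth)
        also have "\<dots> = (\<Sum>k\<in>{j..<N}. ?q (y k))"
          by (rule sum.reindex_bij_witness[of _ "\<lambda>k. k - j" "\<lambda>k. k + j"])
            (auto simp: j_def N_def y_def nth_append)
        finally show ?thesis .
      qed
      ultimately show ?thesis
        using pos_def_kernel_diag[OF pos_def_kernel_mdiff[OF cp, of j N], of v y]
        by (simp add: mdiff_F complex_nonneg_Reals_iff j_def N_def)
    qed
    have "mdiff (map (\<lambda>i. ?q (x i)) [0..<j]) F (?q (x j)) = 0"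
    proof (rule mdiff_homogeneous_eq_0[where C = "sums_of (range ?q)" and n = n])
      show "F (real (Suc k) *\<^sub>R a) = real (Suc k) ^ n * F a" for k a
        using homogeneous_scale[OF hom, of "real (Suc k)" a]
        by (simp add: F_def blinfun.scaleR_left cinner_scaleC_right scaleR_scaleC del: of_nat_Suc)
    qed (use j in \<open>auto intro: mdiff_nonneg_sums_of[OF nonneg] sums_of_0 sums_of_add sums_of_generator\<close>)
    then show ?thesis by (simp add: mdiff_F)
  qed
  show ?thesis
    using mdiff_cblinops[OF linear] by (intro pos_def_kernel_eq_0[OF pd _ diag])
qed

text \<open>Here \<open>b\<^sup>* (a c)\<close> is read as a product of an adjoint \<open>b\<^sup>*\<close> and an arbitrary element \<open>a c\<close>, which
is additive in \<open>a\<close>.\<close>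
lemma mdiff_sandwich_eq_0:
  fixes \<phi> :: "'a \<Rightarrow> 'v::complex_inner \<Rightarrow>\<^sub>L 'v"
  assumes "completely_positive star \<phi>" "range \<phi> \<subseteq> cblinops" "homogeneous n \<phi>"
    and len: "n < length hs"
  shows "mdiff hs (\<lambda>a. \<phi> (star b * (a * c))) a = 0"
proof -
  define j where "j = length hs"
  define y where "y k = (hs @ [a]) ! k * c" for k
  have "mdiff hs (\<lambda>a. \<phi> (star b * (a * c))) a = mdiff (map (\<lambda>h. star b * (h * c)) hs) \<phi> (star b * (a * c))"
    by (rule mdiff_comp) (simp add: distrib_left distrib_right)
  also have "map (\<lambda>h. star b * (h * c)) hs = map (\<lambda>i. star b * y i) [0..<j]"
    by (intro nth_equalityI) (auto simp: y_def j_def nth_append)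
  also have "a * c = y j" by (simp add: y_def j_def)
  also have "mdiff (map (\<lambda>i. star b * y i) [0..<j]) \<phi> (star b * y j) = 0"
    using mdiff_products_eq_0[OF assms(1-3), of j "\<lambda>_. b" y] len by (simp add: j_def)
  finally show ?thesis .
qed

text \<open>With \<open>T\<close> the difference of \<open>\<pi>\<close> and \<open>S = T\<^sup>*\<close>, the hypothesis reads \<open>\<langle>\<pi> b \<xi>, T \<pi> c \<xi>\<rangle> = 0\<close> for all \<open>b\<close>, \<open>c\<close>
and \<open>\<xi>\<close> in the range of \<open>\<iota>\<close>. Since \<open>S\<close> and \<open>T\<close> are combinations of values of \<open>\<pi>\<close>, taking differences in
\<open>c\<close> and \<open>b\<close> replaces \<open>\<pi> c\<close> by \<open>S T\<close> and \<open>\<pi> b\<close> by \<open>T\<close>, and \<open>\<langle>T \<xi>, T S T \<xi>\<rangle> = \<parallel>S T \<xi>\<parallel>\<^sup>2\<close>.\<close>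
lemma mdiff_dilation_eq_0:
  fixes \<phi> :: "'a \<Rightarrow> 'v::complex_inner \<Rightarrow>\<^sub>L 'v" and \<pi> :: "'a \<Rightarrow> 'h::complex_inner \<Rightarrow>\<^sub>L 'h"
  assumes rep: "star_representation star \<pi>" and \<iota>: "is_cadjoint \<iota>' \<iota>"
    and \<phi>: "\<And>a. \<phi> a = \<iota>' o\<^sub>L \<pi> a o\<^sub>L \<iota>"
    and sandwich: "\<And>b c. mdiff hs (\<lambda>a. \<phi> (star b * (a * c))) x = 0"
  shows "mdiff hs \<phi> x = 0"
proof (rule blinfun_eqI)
  fix v
  define \<xi> where "\<xi> = \<iota> v"
  define T S where "T = mdiff hs \<pi> x" and "S = mdiff hs (\<lambda>a. \<pi> (star a)) x"
  have mult: "\<pi> (a * b) y = \<pi> a (\<pi> b y)" for a b y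
    using rep by (simp add: star_representation_def)
  have adj: "cinner (\<pi> (star a) y) z = cinner y (\<pi> a z)" for a y z
    using rep by (simp add: star_representation_def is_cadjoint_def)
  have adj': "cinner (\<pi> a y) z = cinner y (\<pi> (star a) z)" for a y z
    using adj[of "star a"] by (simp add: star_star)
  have compress: "cinner \<xi> (\<pi> a \<xi>) = cinner v (\<phi> a v)" for a
    using \<iota> cinner_commute unfolding is_cadjoint_def \<xi>_def \<phi> by (metis blinfun_apply_blinfun_compose)
  have adjT: "cinner (S y) z = cinner y (T z)" for y z
    unfolding S_def T_def
    using mdiff_additive[of "\<lambda>B. cinner (blinfun_apply B y) z" hs "\<lambda>a. \<pi> (star a)" x]
      mdiff_additive[of "\<lambda>B. cinner y (blinfun_apply B z)" hs \<pi> x]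
    by (simp add: adj blinfun.diff_left cinner_diff_left cinner_diff_right)
  have 1: "cinner (\<pi> b \<xi>) (T (\<pi> c \<xi>)) = 0" for b c
  proof -
    have "cinner (\<pi> b \<xi>) (T (\<pi> c \<xi>)) = mdiff hs (\<lambda>a. cinner (\<pi> b \<xi>) (\<pi> a (\<pi> c \<xi>))) x"
      unfolding T_def by (rule mdiff_additive) (simp add: blinfun.diff_left cinner_diff_right)
    also have "\<dots> = mdiff hs (\<lambda>a. cinner v (\<phi> (star b * (a * c)) v)) x"
      by (simp add: adj' compress[symmetric] mult)
    also have "\<dots> = cinner v (mdiff hs (\<lambda>a. \<phi> (star b * (a * c))) x v)"
      by (rule mdiff_additive[symmetric]) (simp add: blinfun.diff_left cinner_diff_right)
    finally show ?thesis by (simp add: sandwich)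
  qed
  have 2: "cinner (\<pi> b \<xi>) (T (\<pi> c (T \<xi>))) = 0" for b c
  proof -
    have "cinner (\<pi> b \<xi>) (T (\<pi> c (T \<xi>))) = mdiff hs (\<lambda>a. cinner (\<pi> b \<xi>) (T (\<pi> c (\<pi> a \<xi>)))) x"
      unfolding T_def by (rule mdiff_additive) (simp add: blinfun.diff_left blinfun.diff_right cinner_diff_right)
    also have "\<dots> = 0" by (simp add: mult[symmetric] 1)
    finally show ?thesis .
  qed
  have 3: "cinner (\<pi> b \<xi>) (T (S (T \<xi>))) = 0" for b
  proof -
    have "cinner (\<pi> b \<xi>) (T (S (T \<xi>))) = mdiff hs (\<lambda>a. cinner (\<pi> b \<xi>) (T (\<pi> (star a) (T \<xi>)))) x"
      unfolding S_def by (rule mdiff_additive) (simp add: blinfun.diff_left blinfun.diff_right cinner_diff_right)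
    then show ?thesis by (simp add: 2)
  qed
  have "cinner (T \<xi>) (T (S (T \<xi>))) = mdiff hs (\<lambda>a. cinner (\<pi> a \<xi>) (T (S (T \<xi>)))) x"
  proof -
    have "cinner (mdiff hs \<pi> x \<xi>) \<zeta> = mdiff hs (\<lambda>a. cinner (\<pi> a \<xi>) \<zeta>) x" for \<zeta>
      by (rule mdiff_additive) (simp add: blinfun.diff_left cinner_diff_left)
    then show ?thesis by (simp add: T_def)
  qed
  then have "cinner (S (T \<xi>)) (S (T \<xi>)) = 0" by (simp add: 3 adjT)
  then have "S (T \<xi>) = 0" by (simp add: cinner_eq_zero_iff)
  then have "cinner (T \<xi>) (T \<xi>) = 0" using adjT[of "T \<xi>" \<xi>] by simp
  then have "T \<xi> = 0" by (simp add: cinner_eq_zero_iff)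
  moreover have "mdiff hs \<phi> x v = \<iota>' (T \<xi>)"
  proof -
    have "mdiff hs \<phi> x v = mdiff hs (\<lambda>a. \<phi> a v) x"
      by (rule mdiff_additive) (simp add: blinfun.diff_left)
    also have "\<dots> = mdiff hs (\<lambda>a. \<iota>' (\<pi> a \<xi>)) x" by (simp add: \<phi> \<xi>_def)
    also have "\<dots> = \<iota>' (T \<xi>)" unfolding T_def
      by (rule mdiff_additive[symmetric]) (simp add: blinfun.diff_left blinfun.diff_right)
    finally show ?thesis .
  qed
  ultimately show "mdiff hs \<phi> x v = blinfun_apply 0 v" by simp
qed

end

section \<open>Homogeneous functions with vanishing differences are polynomials\<close>

text \<open>The defect of homogeneity \<open>D = A (t x) - t A x\<close> is additive in \<open>t\<close> and vanishes at the integers, so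
\<open>k D\<close> is its value at the fractional part of \<open>k t\<close>. Hence the multiples of \<open>D\<close> are bounded, which
forces \<open>D = 0\<close>.\<close>
lemma linear_of_additive_bounded:
  fixes A :: "'x::real_vector \<Rightarrow> 'y::real_normed_vector"
  assumes add: "\<And>x y. A (x + y) = A x + A y"
    and bounded: "\<And>x. \<exists>B. \<forall>t. 0 \<le> t \<and> t \<le> 1 \<longrightarrow> norm (A (t *\<^sub>R x)) \<le> B"
  shows "linear A"
proof (rule linearI)
  fix t x
  have zero: "A 0 = 0" using add[of 0 0] by simp
  have minus: "A (- y) = - A y" for y using add[of y "- y"] zero by (simp add: eq_neg_iff_add_eq_0 add.commute)
  have nat: "A (real k *\<^sub>R y) = real k *\<^sub>R A y" for k y
    by (induction k) (simp_all add: zero add scaleR_left_distrib)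
  have int: "A (of_int i *\<^sub>R y) = of_int i *\<^sub>R A y" for i y
    by (cases i rule: int_cases2) (use nat minus in auto)
  obtain B where B: "\<And>s. 0 \<le> s \<Longrightarrow> s \<le> 1 \<Longrightarrow> norm (A (s *\<^sub>R x)) \<le> B" using bounded by blast
  define D where "D = A (t *\<^sub>R x) - t *\<^sub>R A x"
  have bound: "real k * norm D \<le> B + norm (A x)" for k
  proof -
    define m s where "m = \<lfloor>real k * t\<rfloor>" and "s = frac (real k * t)"
    have kt: "real k * t = of_int m + s" by (simp add: m_def s_def frac_def)
    have s: "0 \<le> s" "s \<le> 1" unfolding s_def by (simp_all add: frac_lt_1 less_imp_le)
    have "real k *\<^sub>R A (t *\<^sub>R x) = A ((of_int m + s) *\<^sub>R x)" by (simp flip: nat kt)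
    also have "\<dots> = of_int m *\<^sub>R A x + A (s *\<^sub>R x)" by (simp add: scaleR_left_distrib add int)
    finally have "real k *\<^sub>R D = of_int m *\<^sub>R A x + A (s *\<^sub>R x) - (real k * t) *\<^sub>R A x"
      by (simp add: D_def scaleR_diff_right)
    also have "\<dots> = A (s *\<^sub>R x) - s *\<^sub>R A x" by (simp add: kt scaleR_left_distrib)
    finally have "real k *\<^sub>R D = A (s *\<^sub>R x) - s *\<^sub>R A x" .
    then have "real k * norm D = norm (A (s *\<^sub>R x) - s *\<^sub>R A x)"
      by (metis norm_scaleR abs_of_nat)
    also have "\<dots> \<le> norm (A (s *\<^sub>R x)) + s * norm (A x)"
      using norm_triangle_ineq4[of "A (s *\<^sub>R x)" "s *\<^sub>R A x"] s by simp
    also have "\<dots> \<le> B + 1 * norm (A x)" using B s by (intro add_mono mult_right_mono) auto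
    finally show ?thesis by simp
  qed
  have "\<not> 0 < norm D" using reals_Archimedean3[of "norm D"] bound not_less by metis
  then show "A (t *\<^sub>R x) = t *\<^sub>R A x" by (simp add: D_def)
qed (fact add)

context seminormed_involutive_algebra
begin

lemma p_0: "p 0 = 0"
  using p_scaleR[of 0 0] by simp

lemma p_nonneg: "0 \<le> p x"
  using p_add[of x "- x"] p_scaleR[of "- 1" x] p_0 by simp

lemma mdiff_norm_le:
  fixes f :: "'a \<Rightarrow> 'b::real_normed_vector"
  assumes "\<And>y. p y < R \<Longrightarrow> norm (f y) \<le> B" "p x + sum_list (map p hs) < R"
  shows "norm (mdiff hs f x) \<le> 2 ^ length hs * B"
  using assms(2)
proof (induction hs arbitrary: x)
  case (Cons h hs)
  have "norm (mdiff hs f (x + h)) \<le> 2 ^ length hs * B" "norm (mdiff hs f x) \<le> 2 ^ length hs * B"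
    using Cons.prems p_add[of x h] p_nonneg[of h] by (intro Cons.IH; simp)+
  then show ?case using norm_triangle_ineq4[of "mdiff hs f (x + h)" "mdiff hs f x"] by simp
qed (use assms(1) in simp)

text \<open>Homogeneity carries the bound for \<open>f\<close> on the unit ball over to a ball containing all the points
at which the difference evaluates \<open>f\<close>.\<close>
lemma mdiff_bounded:
  fixes f :: "'a \<Rightarrow> 'b::real_normed_vector"
  assumes hom: "homogeneous n f" and bounded: "bounded (f ` seminorm_ball p)"
  shows "\<exists>B\<ge>0. \<forall>hs. length hs = k \<and> (\<forall>h\<in>set hs. p h \<le> R) \<longrightarrow> norm (mdiff hs f 0) \<le> B"
proof -
  obtain B where "B > 0" and B: "\<And>x. p x < 1 \<Longrightarrow> norm (f x) \<le> B"
    using bounded unfolding bounded_pos seminorm_ball_def by auto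
  define Q where "Q = real k * \<bar>R\<bar> + 1"
  have "Q > 0" unfolding Q_def by (simp add: add_nonneg_pos)
  have Q: "norm (f x) \<le> Q ^ n * B" if "p x < Q" for x
  proof -
    have "norm (f (inverse Q *\<^sub>R x)) \<le> B"
      using that \<open>Q > 0\<close> by (intro B) (simp add: p_scaleR field_simps)
    moreover have "f x = Q ^ n *\<^sub>R f (inverse Q *\<^sub>R x)"
      using homogeneous_scale[OF hom \<open>Q > 0\<close>, of "inverse Q *\<^sub>R x"] \<open>Q > 0\<close> by simp
    ultimately show ?thesis using \<open>Q > 0\<close> by simp
  qed
  have "norm (mdiff hs f 0) \<le> 2 ^ k * (Q ^ n * B)"
    if "length hs = k" "\<forall>h\<in>set hs. p h \<le> R" for hs
  proof -
    have "sum_list (map p hs) \<le> real (length hs) * \<bar>R\<bar>"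
      using that(2) by (induction hs) (auto simp: algebra_simps intro: add_mono)
    then have "p 0 + sum_list (map p hs) < Q" using that by (simp add: p_0 Q_def)
    from mdiff_norm_le[OF Q this] that(1) show ?thesis by simp
  qed
  then show ?thesis using \<open>Q > 0\<close> \<open>B > 0\<close> by (intro exI[of _ "2 ^ k * (Q ^ n * B)"]) auto
qed

text \<open>Replacing the base point of the \<open>n\<close>-th difference changes it by a difference of order \<open>n + 1\<close>, that is,
not at all; hence it is additive in each increment, and boundedness upgrades this to linearity.\<close>
lemma mdiff_linear_in_slot:
  fixes f :: "'a \<Rightarrow> 'b::real_normed_vector"
  assumes hom: "homogeneous n f" and bounded: "bounded (f ` seminorm_ball p)"
    and vanish: "\<And>hs x. length hs = Suc n \<Longrightarrow> mdiff hs f x = 0"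
    and len: "length xs = n" and i: "i < n"
  shows "linear (\<lambda>h. mdiff (xs[i := h]) f 0)"
proof -
  define ys where "ys = take i xs @ drop (Suc i) xs"
  have ys: "mdiff (xs[i := h]) f 0 = mdiff (h # ys) f 0" for h
    using len i by (simp add: ys_def upd_conv_take_nth_drop mdiff_middle del: mdiff.simps)
  have len': "length ys = n - 1" using len i by (simp add: ys_def)
  show ?thesis
    unfolding ys
  proof (rule linear_of_additive_bounded)
    fix g h
    have "mdiff (h # ys) f g - mdiff (h # ys) f 0 = mdiff (g # h # ys) f 0" by simp
    also have "\<dots> = 0" using vanish[of "g # h # ys" 0] len' i by (simp del: mdiff.simps)
    finally show "mdiff ((g + h) # ys) f 0 = mdiff (g # ys) f 0 + mdiff (h # ys) f 0"
      unfolding mdiff_Cons_add by (simp del: mdiff.simps)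
  next
    fix h
    define R where "R = sum_list (map p (h # ys))"
    have R: "p y \<le> R" if "y \<in> set (h # ys)" for y
      unfolding R_def by (rule member_le_sum_list) (use that p_nonneg in auto)
    obtain B where B: "\<And>hs. length hs = n \<and> (\<forall>h\<in>set hs. p h \<le> R) \<Longrightarrow> norm (mdiff hs f 0) \<le> B"
      using mdiff_bounded[OF hom bounded, of n R] by blast
    have "norm (mdiff (t *\<^sub>R h # ys) f 0) \<le> B" if t: "0 \<le> t" "t \<le> 1" for t
    proof (rule B)
      have "p (t *\<^sub>R h) \<le> R"
        using R[of h] mult_right_mono[OF t(2) p_nonneg[of h]] t by (simp add: p_scaleR)
      then show "length (t *\<^sub>R h # ys) = n \<and> (\<forall>h\<in>set (t *\<^sub>R h # ys). p h \<le> R)"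
        using R len' i by auto
    qed
    then show "\<exists>B. \<forall>t. 0 \<le> t \<and> t \<le> 1 \<longrightarrow> norm (mdiff (t *\<^sub>R h # ys) f 0) \<le> B" by blast
  qed
qed

text \<open>The function \<open>j \<mapsto> f (j x)\<close> on \<open>nat\<close> is \<open>j\<^sup>n f x\<close>, whose \<open>n\<close>-th difference is \<open>n! f x\<close>.\<close>
lemma mdiff_replicate_homogeneous:
  fixes f :: "'a \<Rightarrow> 'b::real_normed_vector"
  assumes hom: "homogeneous n f"
    and vanish: "\<And>hs x. length hs = Suc n \<Longrightarrow> mdiff hs f x = 0"
  shows "mdiff (replicate n x) f 0 = fact n *\<^sub>R f x"
proof -
  have f: "f (real j *\<^sub>R x) = real j ^ n *\<^sub>R f x" for j
  \<comment> \<open>Homogeneity concerns positive factors only. For \<open>j = 0\<close> it gives \<open>f 0 = 0\<close> if \<open>n > 0\<close>, while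
    for \<open>n = 0\<close> the vanishing first differences say that \<open>f\<close> is constant.\<close>
  proof (cases "j = 0")
    case True
    show ?thesis
    proof (cases n)
      case 0
      with vanish[of "[x]" 0] True show ?thesis by simp
    next
      case (Suc m)
      have "f 0 = (1/2) ^ n *\<^sub>R f 0" using homogeneous_scale[OF hom, of "1/2" 0] by simp
      moreover have "(1/2 :: real) ^ n \<noteq> 1" using Suc power_Suc_less_one[of "1/2::real" m] by simp
      ultimately have "f 0 = 0" by (metis scaleR_cancel_right scaleR_one)
      then show ?thesis using True Suc by simp
    qed
  next
    case False
    then show ?thesis by (intro homogeneous_scale[OF hom]) simp
  qed
  have "mdiff (replicate n x) f 0 = mdiff (replicate n 1) (\<lambda>j. f (real j *\<^sub>R x)) 0"
    using mdiff_comp[of "replicate n (1::nat)" "\<lambda>j. real j *\<^sub>R x" "\<lambda>_. x" f 0]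
    by (simp add: algebra_simps)
  also have "\<dots> = mdiff (replicate n 1) (\<lambda>j. real j ^ n) 0 *\<^sub>R f x"
    unfolding f by (rule mdiff_additive[symmetric]) (simp add: scaleR_left_diff_distrib)
  finally show ?thesis unfolding mdiff_power_eq_fact .
qed

text \<open>The copies of \<open>x\<close> are exchanged for copies of \<open>y\<close> one at a time; each exchange changes the value by
the multilinear map with \<open>y - x = \<delta> z\<close> in one slot, where \<open>p z \<le> 1\<close>. In the
induction, the copies of \<open>y\<close> already inserted move to the list \<open>as\<close>. The bound \<open>\<delta>\<close> replaces \<open>p (y - x)\<close>, which may be zero for \<open>y \<noteq> x\<close>.\<close>
lemma multilinear_replicate_diff:
  fixes \<beta> :: "'a list \<Rightarrow> 'b::real_normed_vector"
  assumes \<beta>: "multilinear_into n S \<beta>"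
    and B: "\<And>hs. length hs = n \<Longrightarrow> \<forall>h\<in>set hs. p h \<le> R \<Longrightarrow> norm (\<beta> hs) \<le> B"
    and R: "1 \<le> R" "p x \<le> R" "p y \<le> R" and \<delta>: "0 < \<delta>" "p (y - x) \<le> \<delta>"
    and "length as + k = n" "\<forall>a\<in>set as. p a \<le> R"
  shows "norm (\<beta> (as @ replicate k y) - \<beta> (as @ replicate k x)) \<le> real k * (\<delta> * B)"
  using assms(8,9)
proof (induction k arbitrary: as)
  case (Suc k)
  define g where "g h = \<beta> (as @ h # replicate k x)" for h
  have "length (as @ 0 # replicate k x) = n" "length as < n" using Suc.prems by auto
  then have "linear (\<lambda>h. \<beta> ((as @ 0 # replicate k x)[length as := h]))"
    using \<beta> unfolding multilinear_into_def by blast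
  then have g: "linear g" unfolding g_def by simp
  define z where "z = inverse \<delta> *\<^sub>R (y - x)"
  have "p z = p (y - x) / \<delta>" using \<delta>(1) by (simp add: z_def p_scaleR divide_inverse mult.commute del: scaleR_diff_right)
  then have "p z \<le> R" using \<delta> R(1) by (simp add: order_trans[of _ 1])
  have "g y - g x = g (\<delta> *\<^sub>R z)" using \<delta>(1) by (simp add: z_def linear_diff[OF g])
  also have "\<dots> = \<delta> *\<^sub>R g z" by (rule linear_scale[OF g])
  finally have "norm (g y - g x) = \<delta> * norm (g z)" using \<delta>(1) by simp
  also have "\<dots> \<le> \<delta> * B"
    unfolding g_def using Suc.prems \<delta>(1) R \<open>p z \<le> R\<close> by (intro mult_left_mono B) auto
  finally have 1: "norm (g y - g x) \<le> \<delta> * B" .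
  have 2: "norm (\<beta> ((as @ [y]) @ replicate k y) - \<beta> ((as @ [y]) @ replicate k x)) \<le> real k * (\<delta> * B)"
    using Suc.prems R by (intro Suc.IH) auto
  have "\<beta> (as @ replicate (Suc k) y) - \<beta> (as @ replicate (Suc k) x) =
    (\<beta> ((as @ [y]) @ replicate k y) - \<beta> ((as @ [y]) @ replicate k x)) + (g y - g x)"
    by (simp add: g_def)
  then show ?case using norm_triangle_mono[OF 2 1] by (simp add: algebra_simps)
qed simp

lemma continuous_map_seminorm_topologyI:
  fixes f :: "'a \<Rightarrow> 'b::metric_space"
  assumes "\<And>x e. 0 < e \<Longrightarrow> \<exists>d>0. \<forall>y. p (y - x) < d \<longrightarrow> dist (f y) (f x) < e"
  shows "continuous_map (seminorm_topology p) euclidean f"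
proof -
  let ?\<B> = "{{y. p (y - x) < e} |x e. 0 < e}"
  have "x \<in> \<Union>?\<B>" for x :: 'a
    by (rule UnionI[of "{y. p (y - x) < 1}"]) (auto simp: p_0 intro!: exI[of _ x] exI[of _ "1::real"])
  then have top: "topspace (seminorm_topology p) = UNIV" by (auto simp: seminorm_topology_def)
  have "openin (seminorm_topology p) (f -` U)" if U: "open U" for U
  proof (subst openin_subopen, intro ballI)
    fix x assume "x \<in> f -` U"
    then obtain e where "0 < e" and e: "\<And>z. dist z (f x) < e \<Longrightarrow> z \<in> U"
      using U unfolding open_dist by auto
    from assms[OF \<open>0 < e\<close>] obtain d where "0 < d" and d: "\<And>y. p (y - x) < d \<Longrightarrow> dist (f y) (f x) < e"
      by blast
    have "openin (seminorm_topology p) {y. p (y - x) < d}"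
      unfolding seminorm_topology_def using \<open>0 < d\<close> by (intro topology_generated_by_Basis) auto
    then show "\<exists>W. openin (seminorm_topology p) W \<and> x \<in> W \<and> W \<subseteq> f -` U"
      using \<open>0 < d\<close> d e by (intro exI[of _ "{y. p (y - x) < d}"]) (auto simp: p_0)
  qed
  then show ?thesis by (auto simp: continuous_map_def top vimage_def)
qed

lemma continuous_map_bounded_multilinear:
  fixes \<beta> :: "'a list \<Rightarrow> 'b::real_normed_vector"
  assumes \<beta>: "multilinear_into n S \<beta>"
    and bounded: "\<And>R. \<exists>B\<ge>0. \<forall>hs. length hs = n \<and> (\<forall>h\<in>set hs. p h \<le> R) \<longrightarrow> norm (\<beta> hs) \<le> B"
  shows "continuous_map (seminorm_topology p) euclidean (\<lambda>x. \<beta> (replicate n x))"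
proof (rule continuous_map_seminorm_topologyI)
  fix x and e :: real
  assume "0 < e"
  define R where "R = p x + 1"
  obtain B where "0 \<le> B" and B: "\<And>hs. length hs = n \<Longrightarrow> \<forall>h\<in>set hs. p h \<le> R \<Longrightarrow> norm (\<beta> hs) \<le> B"
    using bounded[of R] by blast
  define Q where "Q = real n * B + 1"
  have "Q > 0" unfolding Q_def using \<open>0 \<le> B\<close> by (simp add: add_nonneg_pos)
  define \<delta> where "\<delta> = min 1 (e / Q)"
  have "0 < \<delta>" using \<open>0 < e\<close> \<open>Q > 0\<close> by (simp add: \<delta>_def)
  have "norm (\<beta> (replicate n y) - \<beta> (replicate n x)) < e" if y: "p (y - x) < \<delta>" for y
  proof -
    have "p y \<le> R" using p_add[of "y - x" x] y by (simp add: R_def \<delta>_def)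
    then have "norm (\<beta> ([] @ replicate n y) - \<beta> ([] @ replicate n x)) \<le> real n * (\<delta> * B)"
      using y \<open>0 < \<delta>\<close> p_nonneg[of x]
      by (intro multilinear_replicate_diff[OF \<beta> B, where R = R]) (auto simp: R_def)
    also have "\<dots> < \<delta> * Q" using \<open>0 < \<delta>\<close> by (simp add: Q_def algebra_simps)
    also have "\<dots> \<le> e" using \<open>Q > 0\<close> by (simp add: \<delta>_def min_def field_simps)
    finally show ?thesis by simp
  qed
  then show "\<exists>d>0. \<forall>y. p (y - x) < d \<longrightarrow> dist (\<beta> (replicate n y)) (\<beta> (replicate n x)) < e"
    using \<open>0 < \<delta>\<close> by (auto simp: dist_norm)
qed

end

theorem proposition4p6:
  fixes star :: "'a::real_algebra \<Rightarrow> 'a" and p :: "'a \<Rightarrow> real"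
    and \<phi> :: "'a \<Rightarrow> 'v::complex_hilbert_space \<Rightarrow>\<^sub>L 'v" and n :: nat
  assumes "seminormed_involutive_algebra star p"
    and "range \<phi> \<subseteq> cblinops"
    and "dilatable TYPE('h::complex_hilbert_space) star \<phi>"
    and "completely_positive star \<phi>"
    and "homogeneous n \<phi>"
    and "bounded (\<phi> ` seminorm_ball p)"
  shows "homogeneous_polynomial_into n cblinops \<phi> \<and>
         continuous_map (seminorm_topology p) euclidean \<phi>"
proof -
  interpret seminormed_involutive_algebra star p by fact
  obtain \<pi> :: "'a \<Rightarrow> 'h \<Rightarrow>\<^sub>L 'h" and \<iota> \<iota>' where dilation: "star_representation star \<pi>"
    "is_cadjoint \<iota>' \<iota>" "\<And>a. \<phi> a = \<iota>' o\<^sub>L \<pi> a o\<^sub>L \<iota>"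
    using assms(3) unfolding dilatable_def by blast
  have vanish: "mdiff hs \<phi> x = 0" if "length hs = Suc n" for hs x
    by (rule mdiff_dilation_eq_0[OF dilation], rule mdiff_sandwich_eq_0[OF assms(4,2,5)])
      (simp add: that)
  define \<beta> where "\<beta> hs = inverse (fact n) *\<^sub>R mdiff hs \<phi> 0" for hs
  have \<beta>: "multilinear_into n cblinops \<beta>"
    unfolding multilinear_into_def
  proof (intro allI impI conjI)
    show "\<beta> hs \<in> cblinops" for hs
      using mdiff_cblinops[OF assms(2), of hs 0]
      by (simp add: \<beta>_def cblinops_def blinfun.scaleR_left scaleR_scaleC scaleC_scaleC mult.commute)
    show "linear (\<lambda>x. \<beta> (xs[i := x]))" if "length xs = n" "i < n" for xs i
      unfolding \<beta>_def
      using mdiff_linear_in_slot[OF assms(5,6) vanish that]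
      by (rule linear_compose_scale_right)
  qed
  have eq: "\<phi> a = \<beta> (replicate n a)" for a
    using mdiff_replicate_homogeneous[OF assms(5) vanish] by (simp add: \<beta>_def)
  have "\<exists>B\<ge>0. \<forall>hs. length hs = n \<and> (\<forall>h\<in>set hs. p h \<le> R) \<longrightarrow> norm (\<beta> hs) \<le> B" for R
  proof -
    obtain B where "B \<ge> 0" "\<And>hs. length hs = n \<and> (\<forall>h\<in>set hs. p h \<le> R) \<Longrightarrow> norm (mdiff hs \<phi> 0) \<le> B"
      using mdiff_bounded[OF assms(5,6), of n R] by blast
    then show ?thesis
      by (intro exI[of _ "inverse (fact n) * B"]) (auto simp: \<beta>_def intro!: mult_left_mono)
  qed
  then have "continuous_map (seminorm_topology p) euclidean (\<lambda>a. \<beta> (replicate n a))"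
    by (rule continuous_map_bounded_multilinear[OF \<beta>])
  moreover have "(\<lambda>a. \<beta> (replicate n a)) = \<phi>" using eq by (intro ext) (rule sym)
  moreover have "homogeneous_polynomial_into n cblinops \<phi>"
    unfolding homogeneous_polynomial_into_def using \<beta> eq by blast
  ultimately show ?thesis by simp
qed

end
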